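(* Let $N\ge0$ be an integer and $v=(v_0,\dots,v_N)\in\mathbb R^{N+1}$. For real $\alpha,\omega$ let $$\psi_{\alpha,\omega}(x)=\frac\alpha\pi\sin(2\pi\omega x),$$ and let $Q_{\alpha,\omega}=Q_{\psi_{\alpha,\omega}}$ be the divided-difference matrix of this function. Then $$\langle v,Q_{\alpha,\omega}v\rangle=\alpha K_v(\omega).$$ Consequently, if $\mu$ is a finite signed Borel measure on $[0,1]$, $\psi_\mu(x)=\frac1\pi\int_{[0,1]}\sin(2\pi\omega x)\,d\mu(\omega)$ and $Q_\mu=Q_{\psi_\mu}$, then $$\langle v,Q_\mu v\rangle=\int_{[0,1]}K_v(\omega)\,d\mu(\omega).$$
   Context: Notation. $I_N=\{-N,\dots,N\}$. A vector $v\in\mathbb R^{N+1}$ is embedded into symmetric coefficients $u=(u_m)_{m\in I_N}$ by $u_0=v_0$, $u_k=u_{-k}=v_k/\sqrt2$ for $1\le k\le N$. Put $$T_v(t)=\sum_{m=-N}^N u_m e^{2\pi i m t},\qquad K_v(\omega)=2\int_0^\omega T_v(t)\,T_v(\omega-t)\,dt .$$ For a $C^1$ function $\psi$ on $\mathbb R$, the divided-difference matrix $Q_\psi$ is indexed by $I_N\times I_N$ with $(Q_\psi)_{mn}=\frac{\psi(m)-\psi(n)}{m-n}$ for $m\ne n$ and $(Q_\psi)_{mm}=\psi'(m)$. For any matrix $Q$ indexed by $I_N\times I_N$, $\langle v,Qv\rangle:=\sum_{m,n=-N}^N u_mu_nQ_{mn}$. *)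

theory Defs
  imports "HOL-Analysis.Analysis"
begin

text \<open>A vector in \<open>\<real>\<^sup>N\<^sup>+\<^sup>1\<close> is a function \<open>v :: nat \<Rightarrow> real\<close> of which only the entries
  \<open>v 0, \<dots>, v N\<close> are used; the index set \<open>I\<^sub>N\<close> is \<open>{- int N..int N}\<close>.\<close>

definition sym_coeff :: "(nat \<Rightarrow> real) \<Rightarrow> int \<Rightarrow> real" where
  "sym_coeff v m = (if m = 0 then v 0 else v (nat \<bar>m\<bar>) / sqrt 2)"

definition trig_poly :: "nat \<Rightarrow> (nat \<Rightarrow> real) \<Rightarrow> real \<Rightarrow> complex" where
  "trig_poly N v t =
     (\<Sum>m = - int N..int N. of_real (sym_coeff v m) * exp (2 * of_real pi * \<i> * of_int m * of_real t))"

text \<open>The interval integral is oriented, so negative \<open>\<omega>\<close> is covered as well.\<close>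

definition K :: "nat \<Rightarrow> (nat \<Rightarrow> real) \<Rightarrow> real \<Rightarrow> complex" where
  "K N v \<omega> = 2 * (LBINT t=ereal 0..ereal \<omega>. trig_poly N v t * trig_poly N v (\<omega> - t))"

definition div_diff_matrix :: "(real \<Rightarrow> real) \<Rightarrow> int \<Rightarrow> int \<Rightarrow> real" where
  "div_diff_matrix \<psi> m n =
     (if m = n then deriv \<psi> (of_int m)
      else (\<psi> (of_int m) - \<psi> (of_int n)) / (of_int m - of_int n))"

definition quad_form :: "nat \<Rightarrow> (nat \<Rightarrow> real) \<Rightarrow> (int \<Rightarrow> int \<Rightarrow> real) \<Rightarrow> real" where
  "quad_form N v Q =
     (\<Sum>m = - int N..int N. \<Sum>n = - int N..int N. sym_coeff v m * sym_coeff v n * Q m n)"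

text \<open>The measure \<open>M\<close> only supplies the underlying measurable space.\<close>

definition finite_signed_measure :: "'a measure \<Rightarrow> ('a set \<Rightarrow> real) \<Rightarrow> bool" where
  "finite_signed_measure M \<mu> \<longleftrightarrow> \<mu> {} = 0 \<and>
     (\<forall>A :: nat \<Rightarrow> 'a set. range A \<subseteq> sets M \<longrightarrow> disjoint_family A \<longrightarrow>
        (\<lambda>i. \<mu> (A i)) sums \<mu> (\<Union>i. A i))"

text \<open>The positive part of the Jordan decomposition,
  \<open>\<mu>\<^sup>+(A) = sup {\<mu>(B) | B \<subseteq> A measurable}\<close>. Negative values are truncated to 0 by
  \<open>ennreal\<close>, which is harmless because of \<open>B = {}\<close>. The negative part is that of \<open>- \<mu>\<close>.\<close>

definition positive_part :: "'a measure \<Rightarrow> ('a set \<Rightarrow> real) \<Rightarrow> 'a measure" where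
  "positive_part M \<mu> =
     measure_of (space M) (sets M) (\<lambda>A. SUP B\<in>{B \<in> sets M. B \<subseteq> A}. ennreal (\<mu> B))"

definition negative_part :: "'a measure \<Rightarrow> ('a set \<Rightarrow> real) \<Rightarrow> 'a measure" where
  "negative_part M \<mu> = positive_part M (\<lambda>A. - \<mu> A)"

definition signed_integral ::
    "'a measure \<Rightarrow> ('a set \<Rightarrow> real) \<Rightarrow> ('a \<Rightarrow> 'b::{banach, second_countable_topology}) \<Rightarrow> 'b" where
  "signed_integral M \<mu> f =
     integral\<^sup>L (positive_part M \<mu>) f - integral\<^sup>L (negative_part M \<mu>) f"

abbreviation borel_unit_interval :: "real measure" where
  "borel_unit_interval \<equiv> restrict_space borel {0..1}"

definition psi :: "real \<Rightarrow> real \<Rightarrow> real \<Rightarrow> real" where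
  "psi \<alpha> \<omega> x = \<alpha> / pi * sin (2 * pi * \<omega> * x)"

definition psi_signed :: "(real set \<Rightarrow> real) \<Rightarrow> real \<Rightarrow> real" where
  "psi_signed \<mu> x = 1 / pi * signed_integral borel_unit_interval \<mu> (\<lambda>\<omega>. sin (2 * pi * \<omega> * x))"

end

theory Submission
  imports Defs
begin

text \<open>
  Write \<open>e\<^sub>m(t) = exp (2 \<pi> \<i> m t)\<close>. Expanding both factors of the integrand, \<open>K\<^sub>v(\<omega>)\<close> becomes
  \<open>\<Sum> u\<^sub>m u\<^sub>n C\<^sub>m\<^sub>n(\<omega>)\<close> with \<open>C\<^sub>m\<^sub>n(\<omega>) = 2 \<integral>\<^sub>0\<^sup>\<omega> e\<^sub>m(t) e\<^sub>n(\<omega> - t) dt\<close>. This convolution is itself a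
  divided difference: it equals \<open>(e\<^sub>m(\<omega>) - e\<^sub>n(\<omega>)) / (\<pi> \<i> (m - n))\<close> off the diagonal and
  \<open>2 \<omega> e\<^sub>m(\<omega>)\<close> on it. Its real part is therefore the divided-difference matrix of
  \<open>sin (2 \<pi> \<omega> x) / \<pi>\<close>, while its imaginary part is odd under \<open>(m, n) \<mapsto> (- m, - n)\<close> and is
  cancelled in the sum because the coefficients \<open>u\<^sub>m\<close> are even. That is the first claim
  (\<open>quad_form_psi\<close>).

  The second claim integrates the first in \<open>\<omega>\<close>. The quadratic form is a finite linear
  combination of matrix entries, so it suffices that each entry of the divided-difference matrix
  of \<open>\<psi>\<^sub>\<mu>\<close> is the integral of the corresponding entry for a single frequency
  (\<open>div_diff_matrix_psi_signed\<close>). Off the diagonal this is linearity of the integral; on the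
  diagonal it is differentiation under the integral sign. Everything is integrable because the
  integrands are continuous on the compact interval \<open>[0, 1]\<close> and the two parts of the Jordan
  decomposition are finite measures, which comes from the classical fact that a finite signed
  measure is bounded (\<open>finite_signed_measure_bounded\<close>).
\<close>

section \<open>A single frequency\<close>

lemma cis_affine_has_vector_derivative:
  "((\<lambda>t. cis (a + b * t)) has_vector_derivative \<i> * of_real b * cis (a + b * t)) (at t within S)"
proof -
  have "((\<lambda>z. exp (\<i> * (of_real a + of_real b * z))) has_field_derivative
          \<i> * of_real b * exp (\<i> * (of_real a + of_real b * of_real t))) (at (of_real t))"
    by (auto intro!: derivative_eq_intros)
  from has_vector_derivative_real_field[OF this] show ?thesis
    by (simp add: cis_conv_exp)
qed

text \<open>This is the closed form of \<open>2 \<integral>\<^sub>0\<^sup>\<omega> exp (2 \<pi> \<i> m t) exp (2 \<pi> \<i> n (\<omega> - t)) dt\<close>.\<close>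

definition character_convolution :: "real \<Rightarrow> int \<Rightarrow> int \<Rightarrow> complex" where
  "character_convolution \<omega> m n =
     (if m = n then 2 * of_real \<omega> * cis (2 * pi * of_int m * \<omega>)
      else (cis (2 * pi * of_int m * \<omega>) - cis (2 * pi * of_int n * \<omega>))
             / (\<i> * of_real pi * of_int (m - n)))"

lemma trig_poly_eq_cis:
  "trig_poly N v t = (\<Sum>m = - int N..int N. of_real (sym_coeff v m) * cis (2 * pi * of_int m * t))"
  unfolding trig_poly_def cis_conv_exp by (intro sum.cong refl) (simp add: algebra_simps)

text \<open>The product of the two trigonometric polynomials is a finite sum of exponentials in \<open>t\<close>, each
  of which has an explicit antiderivative. The fundamental theorem of calculus is applied to the
  whole double sum at once; its oriented form covers \<open>\<omega> < 0\<close>.\<close>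

lemma K_eq_sum_character_convolution:
  "K N v \<omega> = (\<Sum>m = - int N..int N. \<Sum>n = - int N..int N.
     of_real (sym_coeff v m * sym_coeff v n) * character_convolution \<omega> m n)"
proof -
  let ?I = "{- int N..int N}"
  define c where "c m n = complex_of_real (sym_coeff v m * sym_coeff v n)" for m n
  define F where "F m n t =
     (if m = n then of_real t * cis (2 * pi * of_int m * \<omega>)
      else cis (2 * pi * of_int n * \<omega> + 2 * pi * of_int (m - n) * t)
             / (2 * \<i> * of_real pi * of_int (m - n)))" for m n :: int and t
  define f where "f m n t = cis (2 * pi * of_int n * \<omega> + 2 * pi * of_int (m - n) * t)"
    for m n :: int and t
  have prod: "trig_poly N v t * trig_poly N v (\<omega> - t) = (\<Sum>m\<in>?I. \<Sum>n\<in>?I. c m n * f m n t)" for t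
  proof -
    have "cis (2 * pi * of_int m * t) * cis (2 * pi * of_int n * (\<omega> - t)) = f m n t" for m n :: int
      by (simp add: f_def cis_mult algebra_simps)
    moreover have "of_real x * z * (of_real y * w) = of_real (x * y) * (z * w)"
      for x y :: real and z w :: complex
      by simp
    ultimately have "of_real x * cis (2 * pi * of_int m * t) * (of_real y * cis (2 * pi * of_int n * (\<omega> - t)))
        = of_real (x * y) * f m n t" for m n :: int and x y
      by (simp only:)
    then show ?thesis
      by (simp only: trig_poly_eq_cis sum_product c_def)
  qed
  have F: "(F m n has_vector_derivative f m n t) (at t within S)" for m n t S
  proof (cases "m = n")
    case True
    have "((\<lambda>t. complex_of_real t * cis (2 * pi * of_int m * \<omega>)) has_vector_derivative
            cis (2 * pi * of_int m * \<omega>)) (at t within S)"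
      by (auto intro!: derivative_eq_intros)
    with True show ?thesis by (simp add: F_def[abs_def] f_def)
  next
    case False
    have "((\<lambda>t. cis (2 * pi * of_int n * \<omega> + 2 * pi * of_int (m - n) * t)
             / (2 * \<i> * of_real pi * of_int (m - n))) has_vector_derivative
           (\<i> * of_real (2 * pi * of_int (m - n)) * f m n t) / (2 * \<i> * of_real pi * of_int (m - n)))
           (at t within S)"
      unfolding f_def
      by (intro has_vector_derivative_divide cis_affine_has_vector_derivative)
    with False show ?thesis by (simp add: F_def[abs_def])
  qed
  have "(LBINT t=ereal 0..ereal \<omega>. (\<Sum>m\<in>?I. \<Sum>n\<in>?I. c m n * f m n t))
      = (\<Sum>m\<in>?I. \<Sum>n\<in>?I. c m n * F m n \<omega>) - (\<Sum>m\<in>?I. \<Sum>n\<in>?I. c m n * F m n 0)"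
  proof (rule interval_integral_FTC_finite)
    show "continuous_on {min 0 \<omega>..max 0 \<omega>} (\<lambda>t. \<Sum>m\<in>?I. \<Sum>n\<in>?I. c m n * f m n t)"
      unfolding f_def by (intro continuous_intros)
  qed (intro has_vector_derivative_sum has_vector_derivative_mult_right F)
  also have "\<dots> = (\<Sum>m\<in>?I. \<Sum>n\<in>?I. c m n * (F m n \<omega> - F m n 0))"
    by (simp add: sum_subtractf right_diff_distrib)
  finally have "K N v \<omega> = (\<Sum>m\<in>?I. \<Sum>n\<in>?I. c m n * (2 * (F m n \<omega> - F m n 0)))"
    by (simp only: K_def prod sum_distrib_left mult.left_commute)
  moreover have "2 * (F m n \<omega> - F m n 0) = character_convolution \<omega> m n" for m n
  proof -
    have "2 * pi * of_int n * \<omega> + 2 * pi * of_int (m - n) * \<omega> = 2 * pi * of_int m * \<omega>"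
      by (simp add: algebra_simps)
    then show ?thesis
      by (simp add: F_def character_convolution_def right_diff_distrib diff_divide_distrib mult.assoc
          del: of_int_diff)
  qed
  ultimately show ?thesis by (simp add: c_def)
qed

lemma div_diff_matrix_psi_diagonal:
  "div_diff_matrix (psi \<alpha> \<omega>) m m = \<alpha> * (2 * \<omega> * cos (2 * pi * of_int m * \<omega>))"
proof -
  have "(psi \<alpha> \<omega> has_field_derivative \<alpha> * (2 * \<omega> * cos (2 * pi * of_int m * \<omega>))) (at (of_int m))"
    unfolding psi_def[abs_def]
    by (auto intro!: derivative_eq_intros simp: mult_ac)
  then show ?thesis by (simp add: div_diff_matrix_def DERIV_imp_deriv)
qed

lemma div_diff_matrix_psi_eq_Re:
  "div_diff_matrix (psi \<alpha> \<omega>) m n = \<alpha> * Re (character_convolution \<omega> m n)"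
proof (cases "m = n")
  case True
  then show ?thesis by (simp add: div_diff_matrix_psi_diagonal character_convolution_def)
next
  case False
  have "Re ((z - w) / (\<i> * of_real pi * of_int (m - n))) = (Im z - Im w) / (pi * of_int (m - n))"
    for z w
  proof -
    \<comment> \<open>Dividing by \<open>\<i>\<close> turns the imaginary part of \<open>z - w\<close>, a difference of sines, into the real part.\<close>
    have "(z - w) / (\<i> * of_real pi * of_int (m - n))
        = - \<i> * (z - w) / of_real (pi * of_int (m - n))"
      using False by (simp add: field_simps)
    then show ?thesis by (simp only: Re_divide_of_real) simp
  qed
  with False show ?thesis
    by (simp add: div_diff_matrix_def character_convolution_def psi_def)
       (simp add: diff_divide_distrib right_diff_distrib mult_ac)
qed

lemma sym_coeff_minus: "sym_coeff v (- m) = sym_coeff v m"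
  by (simp add: sym_coeff_def)

text \<open>Negating both indices conjugates the convolution and leaves the coefficients unchanged, so
  the sum equals its own negative.\<close>

lemma sum_Im_character_convolution:
  "(\<Sum>m = - int N..int N. \<Sum>n = - int N..int N.
      sym_coeff v m * sym_coeff v n * Im (character_convolution \<omega> m n)) = 0"
proof -
  let ?I = "{- int N..int N}"
  define g where "g m n = sym_coeff v m * sym_coeff v n * Im (character_convolution \<omega> m n)" for m n
  have "character_convolution \<omega> (- m) (- n) = cnj (character_convolution \<omega> m n)" for m n
    by (auto simp: character_convolution_def cis_cnj field_simps)
  then have g: "g (- m) (- n) = - g m n" for m n
    by (simp add: g_def sym_coeff_minus)
  have reindex: "(\<Sum>m\<in>?I. h m) = (\<Sum>m\<in>?I. h (- m))" for h :: "int \<Rightarrow> real"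
    by (rule sum.reindex_bij_witness[of _ uminus uminus]) auto
  have "(\<Sum>m\<in>?I. \<Sum>n\<in>?I. g m n) = (\<Sum>m\<in>?I. \<Sum>n\<in>?I. g (- m) n)"
    by (rule reindex)
  also have "\<dots> = (\<Sum>m\<in>?I. \<Sum>n\<in>?I. g (- m) (- n))"
    by (intro sum.cong refl reindex)
  also have "\<dots> = - (\<Sum>m\<in>?I. \<Sum>n\<in>?I. g m n)"
    by (simp add: g sum_negf)
  finally show ?thesis by (simp add: g_def)
qed

lemma quad_form_psi:
  "complex_of_real (quad_form N v (div_diff_matrix (psi \<alpha> \<omega>))) = complex_of_real \<alpha> * K N v \<omega>"
proof (rule complex_eqI)
  show "Re (complex_of_real (quad_form N v (div_diff_matrix (psi \<alpha> \<omega>)))) = Re (complex_of_real \<alpha> * K N v \<omega>)"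
    by (simp add: quad_form_def div_diff_matrix_psi_eq_Re K_eq_sum_character_convolution sum_distrib_left mult_ac)
  show "Im (complex_of_real (quad_form N v (div_diff_matrix (psi \<alpha> \<omega>)))) = Im (complex_of_real \<alpha> * K N v \<omega>)"
    using sum_Im_character_convolution by (simp add: K_eq_sum_character_convolution)
qed

section \<open>Boundedness of finite signed measures\<close>

lemma finite_signed_measure_Un:
  assumes \<mu>: "finite_signed_measure M \<mu>" and "A \<in> sets M" "B \<in> sets M" "A \<inter> B = {}"
  shows "\<mu> (A \<union> B) = \<mu> A + \<mu> B"
proof -
  define F where "F = (\<lambda>n::nat. if n = 0 then A else if n = 1 then B else {})"
  have "range F \<subseteq> sets M"
    using assms by (auto simp: F_def)
  moreover have "disjoint_family F"
    using assms(4) by (simp add: F_def disjoint_family_on_def Int_commute)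
  ultimately have "(\<lambda>i. \<mu> (F i)) sums \<mu> (\<Union>i. F i)"
    using \<mu> by (simp add: finite_signed_measure_def)
  moreover have "(\<Union>i. F i) = A \<union> B"
    by (auto simp: F_def split: if_splits)
  moreover have "(\<lambda>i. \<mu> (F i)) sums (\<Sum>i\<in>{0, 1}. \<mu> (F i))"
    using \<mu> by (intro sums_finite) (auto simp: F_def finite_signed_measure_def)
  ultimately have "\<mu> (A \<union> B) = (\<Sum>i\<in>{0, 1}. \<mu> (F i))"
    by (metis sums_unique2)
  then show ?thesis by (simp add: F_def)
qed

text \<open>If \<open>\<mu>\<close> is unbounded on the subsets of \<open>E\<close>, choose \<open>B \<subseteq> E\<close> with \<open>\<bar>\<mu> B\<bar> > \<bar>\<mu> E\<bar> + 1\<close>. Then both \<open>B\<close>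
  and \<open>E - B\<close> have \<open>\<mu>\<close>-value greater than 1 in modulus, and \<open>\<mu>\<close> is again unbounded on the subsets
  of at least one of them. Splitting off the other piece and iterating produces a disjoint sequence
  of sets with \<open>\<bar>\<mu> (A n)\<bar> > 1\<close>, whose values cannot be summable.\<close>

lemma finite_signed_measure_bounded:
  assumes \<mu>: "finite_signed_measure M \<mu>"
  obtains C where "\<And>B. B \<in> sets M \<Longrightarrow> \<bar>\<mu> B\<bar> \<le> C"
proof (rule ccontr)
  assume no_bound: "\<not> thesis"
  define unb where "unb E \<longleftrightarrow> E \<in> sets M \<and> (\<forall>C. \<exists>B\<in>sets M. B \<subseteq> E \<and> \<bar>\<mu> B\<bar> > C)" for E
  have unb_space: "unb (space M)"
    using no_bound that sets.sets_into_space unfolding unb_def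
    by (metis not_le sets.top)
  have split: "\<exists>E'. unb E' \<and> E' \<subseteq> E \<and> \<bar>\<mu> (E - E')\<bar> > 1" if E: "unb E" for E
  proof -
    from E obtain B where B: "B \<in> sets M" "B \<subseteq> E" "\<bar>\<mu> B\<bar> > \<bar>\<mu> E\<bar> + 1"
      unfolding unb_def by blast
    have E_sets: "E \<in> sets M" using E by (simp add: unb_def)
    have "\<mu> E = \<mu> B + \<mu> (E - B)"
      using finite_signed_measure_Un[OF \<mu>, of B "E - B"] B E_sets by (simp add: Un_absorb1)
    then have large: "\<bar>\<mu> B\<bar> > 1" "\<bar>\<mu> (E - B)\<bar> > 1" using B by linarith+
    have "unb B \<or> unb (E - B)"
    proof (rule ccontr)
      assume "\<not> ?thesis"
      then obtain C D where C: "\<And>S. S \<in> sets M \<Longrightarrow> S \<subseteq> B \<Longrightarrow> \<bar>\<mu> S\<bar> \<le> C"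
        and D: "\<And>S. S \<in> sets M \<Longrightarrow> S \<subseteq> E - B \<Longrightarrow> \<bar>\<mu> S\<bar> \<le> D"
        using B(1) E_sets unfolding unb_def by (meson not_le sets.Diff)
      from E obtain S where S: "S \<in> sets M" "S \<subseteq> E" "\<bar>\<mu> S\<bar> > C + D"
        unfolding unb_def by blast
      have "\<mu> ((S \<inter> B) \<union> (S - B)) = \<mu> (S \<inter> B) + \<mu> (S - B)"
        using S B by (intro finite_signed_measure_Un[OF \<mu>]) auto
      then have "\<mu> S = \<mu> (S \<inter> B) + \<mu> (S - B)" by (simp add: Int_Diff_Un)
      moreover have "\<bar>\<mu> (S \<inter> B)\<bar> \<le> C" "\<bar>\<mu> (S - B)\<bar> \<le> D"
        using S B by (auto intro!: C D)
      ultimately show False using S(3) by linarith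
    qed
    moreover have "E - (E - B) = B" using B by blast
    ultimately show ?thesis using large B by (metis Diff_subset)
  qed
  obtain E :: "nat \<Rightarrow> 'a set" where E: "\<And>n. unb (E n)"
      "\<And>n. E (Suc n) \<subseteq> E n \<and> \<bar>\<mu> (E n - E (Suc n))\<bar> > 1"
    using dependent_nat_choice[of "\<lambda>_ E. unb E" "\<lambda>_ E E'. E' \<subseteq> E \<and> \<bar>\<mu> (E - E')\<bar> > 1"]
      unb_space split by metis
  define A where "A n = E n - E (Suc n)" for n
  have dec: "E n \<subseteq> E m" if "m \<le> n" for m n
    using that E(2) by (meson lift_Suc_antimono_le)
  have "disjoint_family A"
  proof -
    have "A m \<inter> A n = {}" if "m < n" for m n
      using dec[of "Suc m" n] that by (auto simp: A_def)
    then show ?thesis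
      unfolding disjoint_family_on_def by (metis inf_commute linorder_neqE_nat)
  qed
  moreover have "range A \<subseteq> sets M"
    using E(1) by (auto simp: A_def unb_def)
  ultimately have "summable (\<lambda>n. \<mu> (A n))"
    using \<mu> by (auto simp: finite_signed_measure_def sums_iff)
  then have "(\<lambda>n. \<mu> (A n)) \<longlonglongrightarrow> 0" by (rule summable_LIMSEQ_zero)
  then have "\<forall>\<^sub>F n in sequentially. \<bar>\<mu> (A n)\<bar> < 1"
    using tendstoD[of "\<lambda>n. \<mu> (A n)" 0 sequentially 1] by (simp add: dist_real_def)
  then obtain n where "\<bar>\<mu> (A n)\<bar> < 1"
    by (auto simp: eventually_sequentially)
  with E(2)[of n] show False by (simp add: A_def)
qed

lemma finite_signed_measure_uminus:
  "finite_signed_measure M \<mu> \<Longrightarrow> finite_signed_measure M (\<lambda>A. - \<mu> A)"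
  by (auto simp: finite_signed_measure_def intro: sums_minus)

lemma sets_positive_part [simp]: "sets (positive_part M \<mu>) = sets M"
  by (simp add: positive_part_def)

lemma sets_negative_part [simp]: "sets (negative_part M \<mu>) = sets M"
  by (simp add: negative_part_def)

lemma finite_measure_positive_part:
  assumes "finite_signed_measure M \<mu>"
  shows "finite_measure (positive_part M \<mu>)"
proof
  obtain C where C: "\<And>B. B \<in> sets M \<Longrightarrow> \<bar>\<mu> B\<bar> \<le> C"
    using finite_signed_measure_bounded[OF assms] by blast
  have "(SUP B\<in>{B \<in> sets M. B \<subseteq> space M}. ennreal (\<mu> B)) \<le> ennreal C"
    using C by (intro SUP_least ennreal_leI) fastforce
  then have "(SUP B\<in>{B \<in> sets M. B \<subseteq> space M}. ennreal (\<mu> B)) < \<infinity>"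
    by (rule order.strict_trans1) simp
  \<comment> \<open>By the totality conventions of \<open>measure_of\<close>, the mass of the space is this supremum or 0.\<close>
  then show "emeasure (positive_part M \<mu>) (space (positive_part M \<mu>)) \<noteq> \<infinity>"
    unfolding positive_part_def emeasure_measure_of_conv space_measure_of_conv
    by (metis infinity_ennreal_def ennreal_zero_neq_top less_irrefl)
qed

lemma finite_measure_negative_part:
  "finite_signed_measure M \<mu> \<Longrightarrow> finite_measure (negative_part M \<mu>)"
  unfolding negative_part_def
  by (intro finite_measure_positive_part finite_signed_measure_uminus)

section \<open>Integration over frequencies\<close>

lemma borel_measurable_unit_interval:
  assumes "sets P = sets borel_unit_interval" "continuous_on UNIV f"
  shows "f \<in> borel_measurable P"
  using assms(2) measurable_cong_sets[OF assms(1) refl]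
  by (metis borel_measurable_continuous_onI measurable_restrict_space1)

lemma space_unit_interval:
  assumes "sets P = sets borel_unit_interval"
  shows "space P = {0..1}"
  using sets_eq_imp_space_eq[OF assms] by (simp add: space_restrict_space)

lemma integrable_continuous_unit_interval:
  fixes f :: "real \<Rightarrow> real"
  assumes P: "sets P = sets borel_unit_interval" "finite_measure P" and f: "continuous_on UNIV f"
  shows "integrable P f"
proof -
  interpret finite_measure P by fact
  have "compact (f ` {0..1})"
    by (intro compact_continuous_image continuous_on_subset[OF f]) auto
  then obtain B where "\<And>x. x \<in> {0..1} \<Longrightarrow> norm (f x) \<le> B"
    by (meson bounded_iff compact_imp_bounded imageI)
  then show ?thesis
    using space_unit_interval[OF P(1)]
    by (intro integrable_const_bound[of _ B] borel_measurable_unit_interval P f) auto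
qed

text \<open>The mean value inequality for \<open>t \<mapsto> sin t - t cos a\<close>, whose derivative \<open>cos t - cos a\<close> is at most
  \<open>\<bar>t - a\<bar>\<close> in modulus.\<close>

lemma sin_taylor_remainder:
  fixes a h :: real
  shows "\<bar>sin (a + h) - sin a - h * cos a\<bar> \<le> h\<^sup>2"
proof -
  have "\<bar>cos t - cos a\<bar> \<le> \<bar>h\<bar>" if "t \<in> closed_segment a (a + h)" for t
  proof -
    have "\<bar>cos t - cos a\<bar> = 2 * \<bar>sin ((t + a) / 2)\<bar> * \<bar>sin ((a - t) / 2)\<bar>"
      by (simp add: cos_diff_cos abs_mult)
    also have "\<dots> \<le> 2 * 1 * \<bar>(a - t) / 2\<bar>"
      by (intro mult_mono abs_sin_x_le_abs_x) auto
    also have "\<dots> \<le> \<bar>h\<bar>"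
      using that by (auto simp: closed_segment_eq_real_ivl split: if_splits)
    finally show ?thesis .
  qed
  moreover have "((\<lambda>t. sin t - t * cos a) has_field_derivative cos t - cos a)
      (at t within closed_segment a (a + h))" for t
    by (auto intro!: derivative_eq_intros)
  ultimately have "norm ((sin (a + h) - (a + h) * cos a) - (sin a - a * cos a)) \<le> \<bar>h\<bar> * norm (a + h - a)"
    by (intro field_differentiable_bound[where S = "closed_segment a (a + h)"
          and f' = "\<lambda>t. cos t - cos a"]) auto
  then show ?thesis
    by (simp add: algebra_simps power2_eq_square flip: abs_mult)
qed

text \<open>The Taylor remainder of \<open>x \<mapsto> sin (2 \<pi> \<omega> x)\<close> at step \<open>h\<close> is at most \<open>(2 \<pi> h)\<^sup>2\<close>, uniformly in
  \<open>\<omega> \<in> [0, 1]\<close>. Integrating this bound against a finite measure gives a remainder of order \<open>h\<^sup>2\<close>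
  for the integral, so the derivative may be taken under the integral sign.\<close>

lemma integral_sin_has_field_derivative:
  assumes P: "sets P = sets borel_unit_interval" "finite_measure P"
  shows "((\<lambda>x. \<integral>\<omega>. sin (2 * pi * \<omega> * x) \<partial>P) has_field_derivative
           (\<integral>\<omega>. 2 * pi * \<omega> * cos (2 * pi * \<omega> * x) \<partial>P)) (at x)"
proof -
  interpret finite_measure P by fact
  note integrable = integrable_continuous_unit_interval[OF P]
  let ?F = "\<lambda>x. \<integral>\<omega>. sin (2 * pi * \<omega> * x) \<partial>P"
  let ?D = "\<integral>\<omega>. 2 * pi * \<omega> * cos (2 * pi * \<omega> * x) \<partial>P"
  define C where "C = (2 * pi)\<^sup>2 * measure P (space P)"
  have bound: "\<bar>?F (x + h) - ?F x - h * ?D\<bar> \<le> C * h\<^sup>2" for h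
  proof -
    let ?g = "\<lambda>\<omega>. sin (2 * pi * \<omega> * (x + h)) - sin (2 * pi * \<omega> * x)
                    - h * (2 * pi * \<omega> * cos (2 * pi * \<omega> * x))"
    have pointwise: "\<bar>?g \<omega>\<bar> \<le> (2 * pi)\<^sup>2 * h\<^sup>2" if "\<omega> \<in> space P" for \<omega>
    proof -
      have \<omega>: "0 \<le> \<omega>" "\<omega> \<le> 1" using that by (simp_all add: space_unit_interval[OF P(1)])
      have "2 * pi * \<omega> * (x + h) = 2 * pi * \<omega> * x + 2 * pi * \<omega> * h"
        by (simp only: distrib_left)
      then have "\<bar>?g \<omega>\<bar> \<le> (2 * pi * \<omega> * h)\<^sup>2"
        using sin_taylor_remainder[of "2 * pi * \<omega> * x" "2 * pi * \<omega> * h"]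
        by (simp only: mult_ac)
      also have "\<dots> = ((2 * pi)\<^sup>2 * h\<^sup>2) * \<omega>\<^sup>2" by (simp only: power_mult_distrib mult_ac)
      also have "\<dots> \<le> (2 * pi)\<^sup>2 * h\<^sup>2"
        using \<omega> by (intro mult_right_le_one_le) (auto simp: power_le_one)
      finally show ?thesis .
    qed
    have "?F (x + h) - ?F x - h * ?D = (\<integral>\<omega>. ?g \<omega> \<partial>P)"
      by (simp add: integrable continuous_intros)
    then have "\<bar>?F (x + h) - ?F x - h * ?D\<bar> \<le> (\<integral>\<omega>. \<bar>?g \<omega>\<bar> \<partial>P)"
      by (simp only: integral_abs_bound)
    also have "(\<integral>\<omega>. \<bar>?g \<omega>\<bar> \<partial>P) \<le> (\<integral>\<omega>. (2 * pi)\<^sup>2 * h\<^sup>2 \<partial>P)"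
      by (rule integral_mono[OF integrable integrable pointwise])
         (auto intro!: continuous_intros)
    finally show ?thesis by (simp add: C_def mult_ac)
  qed
  have "((\<lambda>h. (?F (x + h) - ?F x) / h - ?D) \<longlongrightarrow> 0) (at 0)"
  proof (rule Lim_null_comparison)
    show "\<forall>\<^sub>F h in at 0. norm ((?F (x + h) - ?F x) / h - ?D) \<le> C * \<bar>h\<bar>"
    proof (rule eventually_at_filter[THEN iffD2], rule always_eventually, intro allI impI)
      fix h :: real assume "h \<noteq> 0"
      then have "\<bar>(?F (x + h) - ?F x) / h - ?D\<bar> = \<bar>?F (x + h) - ?F x - h * ?D\<bar> / \<bar>h\<bar>"
        by (subst abs_divide[symmetric]) (simp add: diff_divide_distrib)
      also have "\<dots> \<le> C * h\<^sup>2 / \<bar>h\<bar>" by (intro divide_right_mono bound) simp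
      also have "\<dots> = C * \<bar>h\<bar>" using \<open>h \<noteq> 0\<close> by (simp add: field_simps power2_eq_square)
      finally show "norm ((?F (x + h) - ?F x) / h - ?D) \<le> C * \<bar>h\<bar>" by simp
    qed
    show "((\<lambda>h. C * \<bar>h\<bar>) \<longlongrightarrow> 0) (at 0)" by (auto intro!: tendsto_eq_intros)
  qed
  then show ?thesis by (simp add: DERIV_def LIM_zero_iff)
qed

text \<open>Taking divided differences and integrating over \<open>\<omega>\<close> commute, first against each part of the
  Jordan decomposition and then against their difference.\<close>

lemma div_diff_matrix_psi_signed:
  assumes \<mu>: "finite_signed_measure borel_unit_interval \<mu>"
  shows "div_diff_matrix (psi_signed \<mu>) m n
       = signed_integral borel_unit_interval \<mu> (\<lambda>\<omega>. div_diff_matrix (psi 1 \<omega>) m n)"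
proof -
  define P where "P = positive_part borel_unit_interval \<mu>"
  define R where "R = negative_part borel_unit_interval \<mu>"
  have P: "sets P = sets borel_unit_interval" "finite_measure P"
    using \<mu> by (simp_all add: P_def finite_measure_positive_part)
  have R: "sets R = sets borel_unit_interval" "finite_measure R"
    using \<mu> by (simp_all add: R_def finite_measure_negative_part)
  have signed: "signed_integral borel_unit_interval \<mu> f = integral\<^sup>L P f - integral\<^sup>L R f"
    for f :: "real \<Rightarrow> real"
    by (simp add: signed_integral_def P_def R_def)
  show ?thesis
  proof (cases "m = n")
    case True
    have "(psi_signed \<mu> has_field_derivative
            1 / pi * ((\<integral>\<omega>. 2 * pi * \<omega> * cos (2 * pi * \<omega> * of_int m) \<partial>P)
                    - (\<integral>\<omega>. 2 * pi * \<omega> * cos (2 * pi * \<omega> * of_int m) \<partial>R))) (at (of_int m))"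
      unfolding psi_signed_def[abs_def] signed
      by (intro DERIV_cmult DERIV_diff integral_sin_has_field_derivative P R)
    then have "div_diff_matrix (psi_signed \<mu>) m m =
            1 / pi * ((\<integral>\<omega>. 2 * pi * \<omega> * cos (2 * pi * \<omega> * of_int m) \<partial>P)
                    - (\<integral>\<omega>. 2 * pi * \<omega> * cos (2 * pi * \<omega> * of_int m) \<partial>R))"
      by (simp only: div_diff_matrix_def DERIV_imp_deriv refl if_True)
    also have "\<dots> = (\<integral>\<omega>. 1 / pi * (2 * pi * \<omega> * cos (2 * pi * \<omega> * of_int m)) \<partial>P)
                    - (\<integral>\<omega>. 1 / pi * (2 * pi * \<omega> * cos (2 * pi * \<omega> * of_int m)) \<partial>R)"
      unfolding integral_mult_right_zero right_diff_distrib ..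
    finally show ?thesis
      using True by (simp add: div_diff_matrix_psi_diagonal signed mult_ac)
  next
    case False
    have int: "(\<integral>\<omega>. div_diff_matrix (psi 1 \<omega>) m n \<partial>S)
        = (1 / pi * (\<integral>\<omega>. sin (2 * pi * \<omega> * of_int m) \<partial>S)
          - 1 / pi * (\<integral>\<omega>. sin (2 * pi * \<omega> * of_int n) \<partial>S)) / (of_int m - of_int n)"
      if S: "sets S = sets borel_unit_interval" "finite_measure S" for S
      using False
      by (simp add: div_diff_matrix_def psi_def integrable_continuous_unit_interval[OF S] continuous_intros)
    show ?thesis
      using False unfolding signed int[OF P] int[OF R]
      by (simp add: div_diff_matrix_def psi_signed_def signed right_diff_distrib diff_divide_distrib)
  qed
qed

lemma quad_form_psi_signed:
  assumes \<mu>: "finite_signed_measure borel_unit_interval \<mu>"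
  shows "complex_of_real (quad_form N v (div_diff_matrix (psi_signed \<mu>)))
       = signed_integral borel_unit_interval \<mu> (K N v)"
proof -
  let ?I = "{- int N..int N}"
  define q where "q m n \<omega> = div_diff_matrix (psi 1 \<omega>) m n" for m n \<omega>
  have q: "continuous_on UNIV (q m n)" for m n
  proof (cases "m = n")
    case True
    then show ?thesis
      by (simp add: q_def[abs_def] div_diff_matrix_psi_diagonal continuous_intros)
  next
    case False
    then show ?thesis
      by (simp add: q_def[abs_def] div_diff_matrix_def psi_def continuous_intros)
  qed
  have integral: "integral\<^sup>L P (K N v)
      = of_real (\<Sum>m\<in>?I. \<Sum>n\<in>?I. sym_coeff v m * sym_coeff v n * integral\<^sup>L P (q m n))"
    if P: "sets P = sets borel_unit_interval" "finite_measure P" for P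
  proof -
    have "K N v = (\<lambda>\<omega>. of_real (\<Sum>m\<in>?I. \<Sum>n\<in>?I. sym_coeff v m * sym_coeff v n * q m n \<omega>))"
      using quad_form_psi[of N v 1] by (simp add: q_def quad_form_def fun_eq_iff)
    then show ?thesis
      by (simp add: integrable_continuous_unit_interval[OF P q] integral_complex_of_real
          del: of_real_sum of_real_mult)
  qed
  show ?thesis
    using \<mu>
    by (simp add: signed_integral_def integral finite_measure_positive_part
        finite_measure_negative_part quad_form_def div_diff_matrix_psi_signed q_def[abs_def]
        right_diff_distrib sum_subtractf)
qed

theorem lemma2p3:
  fixes N :: nat and v :: "nat \<Rightarrow> real"
  shows "(\<forall>\<alpha> \<omega> :: real.
            complex_of_real (quad_form N v (div_diff_matrix (psi \<alpha> \<omega>)))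
              = complex_of_real \<alpha> * K N v \<omega>) \<and>
         (\<forall>\<mu> :: real set \<Rightarrow> real. finite_signed_measure borel_unit_interval \<mu> \<longrightarrow>
            complex_of_real (quad_form N v (div_diff_matrix (psi_signed \<mu>)))
              = signed_integral borel_unit_interval \<mu> (K N v))"
  using quad_form_psi quad_form_psi_signed by blast

end
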